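(* Suppose a simple graph $G$ on $n$ vertices has an $\varepsilon$-factorization $(H,K,E)$ with respect to the ordering $V(G)=\{v_1,\dots,v_n\}$. Then for every $(i,j)\in\mathrm{Good}$, \[ |N_H(v_i)\cap N_K(v_j)|=A(G)_{ij}\in\{0,1\}. \]
   Context: All graphs are finite, simple and undirected; $N_H(u)$ is the set of neighbours of $u$ in $H$ and $A(H)$ is the adjacency matrix of $H$. Let $0\le\varepsilon\le 1$. An $\varepsilon$-factorization $(H,K,E)$ of $G$ with respect to the ordering $v_1,\dots,v_n$ consists of simple graphs $H,K$ on $V(G)$ and a matrix $E\in\{0,1\}^{n\times n}$ with at most $\varepsilon n^2$ nonzero entries such that $(A(H)A(K)-A(G))\odot(J-E)=0$, where $\odot$ is the entrywise product and $J$ the all-ones matrix. $\mathrm{Good}:=\{(i,j)\in[n]\times[n]:E_{ij}=0\}$ is the set of non-error entries. *)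

theory Defs
  imports "Graph_Theory.Pair_Digraph" "Jordan_Normal_Form.Matrix"
begin

text \<open>
  A simple undirected graph is a \<^locale>\<open>pair_graph\<close>: a finite loop-free digraph whose arc set is a
  symmetric set of vertex pairs, an edge \<open>uv\<close> being the two arcs \<open>(u, v)\<close> and \<open>(v, u)\<close>.

  A vertex ordering is a distinct list \<open>vs\<close> enumerating the vertices. Lists and matrices are
  indexed from 0, so the vertex \<open>v\<^sub>i\<close> with \<open>1 \<le> i \<le> n\<close> is \<open>vs ! (i - 1)\<close>, and \<open>[n]\<close> becomes
  \<open>{..<n}\<close>.
\<close>

definition nbrs :: "'a pair_pre_digraph \<Rightarrow> 'a \<Rightarrow> 'a set" where
  "nbrs H u = {w \<in> pverts H. (u, w) \<in> parcs H}"

definition adj_mat :: "'a list \<Rightarrow> 'a pair_pre_digraph \<Rightarrow> int mat" where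
  "adj_mat vs H =
    mat (length vs) (length vs) (\<lambda>(i, j). if (vs ! i, vs ! j) \<in> parcs H then 1 else 0)"

definition vertex_ordering :: "'a pair_pre_digraph \<Rightarrow> 'a list \<Rightarrow> bool" where
  "vertex_ordering G vs \<longleftrightarrow> distinct vs \<and> set vs = pverts G"

definition entrywise_prod :: "'b::times mat \<Rightarrow> 'b mat \<Rightarrow> 'b mat" (infixl "\<odot>" 70) where
  "A \<odot> B = mat (dim_row A) (dim_col A) (\<lambda>ij. A $$ ij * B $$ ij)"

definition all_ones_mat :: "nat \<Rightarrow> int mat" where
  "all_ones_mat n = mat n n (\<lambda>_. 1)"

definition eps_factorization ::
  "real \<Rightarrow> 'a pair_pre_digraph \<Rightarrow> 'a list \<Rightarrow>
    'a pair_pre_digraph \<Rightarrow> 'a pair_pre_digraph \<Rightarrow> int mat \<Rightarrow> bool"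
where
  "eps_factorization \<epsilon> G vs H K E \<longleftrightarrow>
    (let n = length vs in
      pair_graph H \<and> pverts H = pverts G \<and>
      pair_graph K \<and> pverts K = pverts G \<and>
      E \<in> carrier_mat n n \<and>
      (\<forall>i<n. \<forall>j<n. E $$ (i, j) \<in> {0, 1}) \<and>
      real (card {(i, j). i < n \<and> j < n \<and> E $$ (i, j) \<noteq> 0}) \<le> \<epsilon> * real n ^ 2 \<and>
      (adj_mat vs H * adj_mat vs K - adj_mat vs G) \<odot> (all_ones_mat n - E) = 0\<^sub>m n n)"

definition Good :: "nat \<Rightarrow> int mat \<Rightarrow> (nat \<times> nat) set" where
  "Good n E = {(i, j) \<in> {..<n} \<times> {..<n}. E $$ (i, j) = 0}"

end

theory Submission
  imports Defs
begin

text \<open>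
  The entry \<open>(i, j)\<close> of \<open>A(H) A(K)\<close> counts the walks \<open>v\<^sub>i w v\<^sub>j\<close> whose first step is an edge of
  \<open>H\<close> and whose second step is an edge of \<open>K\<close>. As \<open>K\<close> is undirected, the middle vertices of these
  walks are exactly the common elements of \<open>N\<^sub>H(v\<^sub>i)\<close> and \<open>N\<^sub>K(v\<^sub>j)\<close>
  (\<open>adj_mat_times_eq_card_common_nbrs\<close>). At a non-error position the matrix \<open>J - E\<close> has entry 1,
  so the defining equation of the factorization forces the entries of \<open>A(H) A(K)\<close> and \<open>A(G)\<close> to
  coincide there (\<open>eps_factorization_entry_eq\<close>), and the latter is 0 or 1.
\<close>

lemma adj_mat_carrier: "adj_mat vs H \<in> carrier_mat (length vs) (length vs)"
  by (simp add: adj_mat_def)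

lemma adj_mat_index:
  assumes "i < length vs" and "j < length vs"
  shows "adj_mat vs H $$ (i, j) = (if (vs ! i, vs ! j) \<in> parcs H then 1 else 0)"
  using assms by (simp add: adj_mat_def)

text \<open>
  Expanding the product gives a sum of indicators of the positions of the middle vertices; since
  the list enumerates the vertices without repetition, counting positions is counting vertices.
  Symmetry of \<open>K\<close> turns the arc into \<open>v\<^sub>j\<close> into one out of \<open>v\<^sub>j\<close>.
\<close>

lemma adj_mat_times_eq_card_common_nbrs:
  assumes K: "pair_sym_digraph K" and vertices: "pverts K = pverts H"
    and ord: "vertex_ordering H vs"
    and i: "i < length vs" and j: "j < length vs"
  shows "(adj_mat vs H * adj_mat vs K) $$ (i, j) =
    int (card (nbrs H (vs ! i) \<inter> nbrs K (vs ! j)))"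
proof -
  define P where "P = {k. k < length vs \<and>
    (vs ! i, vs ! k) \<in> parcs H \<and> (vs ! k, vs ! j) \<in> parcs K}"
  have "distinct vs" and set_vs: "set vs = pverts H"
    using ord by (auto simp: vertex_ordering_def)
  have "(adj_mat vs H * adj_mat vs K) $$ (i, j) =
      (\<Sum>k<length vs. adj_mat vs H $$ (i, k) * adj_mat vs K $$ (k, j))"
    using i j adj_mat_carrier[of vs H] adj_mat_carrier[of vs K]
    by (auto simp: scalar_prod_def lessThan_atLeast0 intro!: sum.cong)
  also have "\<dots> = (\<Sum>k<length vs. if k \<in> P then 1 else 0)"
    using i j by (intro sum.cong) (auto simp: adj_mat_index P_def)
  also have "\<dots> = int (card P)"
  proof -
    have "{..<length vs} \<inter> {k. k \<in> P} = P"
      by (auto simp: P_def)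
    then show ?thesis by (simp add: sum.If_cases)
  qed
  also have "card P = card ((!) vs ` P)"
    using \<open>distinct vs\<close>
    by (intro card_image[symmetric] inj_onI) (auto simp: P_def nth_eq_iff_index_eq)
  also have "(!) vs ` P = nbrs H (vs ! i) \<inter> nbrs K (vs ! j)"
  proof -
    have sym: "(u, w) \<in> parcs K \<longleftrightarrow> (w, u) \<in> parcs K" for u w
      using pair_sym_digraph.arcs_symmetric[OF K] by blast
    have "w \<in> (!) vs ` P \<longleftrightarrow>
        w \<in> set vs \<and> (vs ! i, w) \<in> parcs H \<and> (w, vs ! j) \<in> parcs K" for w
      by (auto simp: P_def in_set_conv_nth)
    then show ?thesis
      using sym set_vs vertices by (auto simp: nbrs_def)
  qed
  finally show ?thesis .
qed

lemma eps_factorization_entry_eq: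
  assumes fact: "eps_factorization \<epsilon> G vs H K E"
    and good: "(i, j) \<in> Good (length vs) E"
  shows "(adj_mat vs H * adj_mat vs K) $$ (i, j) = adj_mat vs G $$ (i, j)"
proof -
  have i: "i < length vs" and j: "j < length vs" and E0: "E $$ (i, j) = 0"
    using good by (auto simp: Good_def)
  have E: "E \<in> carrier_mat (length vs) (length vs)"
    and zero: "(adj_mat vs H * adj_mat vs K - adj_mat vs G) \<odot> (all_ones_mat (length vs) - E) =
      0\<^sub>m (length vs) (length vs)"
    using fact by (auto simp: eps_factorization_def Let_def)
  have "((adj_mat vs H * adj_mat vs K - adj_mat vs G) \<odot> (all_ones_mat (length vs) - E)) $$ (i, j) =
      (adj_mat vs H * adj_mat vs K) $$ (i, j) - adj_mat vs G $$ (i, j)"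
    using i j E E0
    by (simp add: entrywise_prod_def all_ones_mat_def adj_mat_def del: index_mult_mat(1))
  then show ?thesis
    using zero i j by simp
qed

theorem lemma2:
  fixes G H K :: "'a pair_pre_digraph" and vs :: "'a list"
    and E :: "int mat" and n :: nat and \<epsilon> :: real
  assumes "0 \<le> \<epsilon>" and "\<epsilon> \<le> 1"
    and "pair_graph G" and "card (pverts G) = n"
    and "vertex_ordering G vs"
    and "eps_factorization \<epsilon> G vs H K E"
  shows "\<forall>(i, j) \<in> Good n E.
    int (card (nbrs H (vs ! i) \<inter> nbrs K (vs ! j))) = adj_mat vs G $$ (i, j) \<and>
    adj_mat vs G $$ (i, j) \<in> {0, 1}"
proof (intro ballI, clarify)
  fix i j
  assume good: "(i, j) \<in> Good n E"
  have n: "n = length vs"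
    using assms(4,5) by (metis vertex_ordering_def distinct_card)
  then have i: "i < length vs" and j: "j < length vs"
    using good by (auto simp: Good_def)
  have vH: "pverts H = pverts G" and K: "pair_graph K" and vK: "pverts K = pverts G"
    using assms(6) by (auto simp: eps_factorization_def Let_def)
  have "(adj_mat vs H * adj_mat vs K) $$ (i, j) =
      int (card (nbrs H (vs ! i) \<inter> nbrs K (vs ! j)))"
  proof (rule adj_mat_times_eq_card_common_nbrs)
    show "pair_sym_digraph K"
      using K by (simp add: pair_graph_def pair_pseudo_graph_def)
    show "pverts K = pverts H"
      using vH vK by simp
    show "vertex_ordering H vs"
      using assms(5) vH by (simp add: vertex_ordering_def)
  qed (fact i j)+
  moreover have "(adj_mat vs H * adj_mat vs K) $$ (i, j) = adj_mat vs G $$ (i, j)"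
    using assms(6) good n by (intro eps_factorization_entry_eq) auto
  moreover have "adj_mat vs G $$ (i, j) \<in> {0, 1}"
    using i j by (simp add: adj_mat_index)
  ultimately show "int (card (nbrs H (vs ! i) \<inter> nbrs K (vs ! j))) = adj_mat vs G $$ (i, j) \<and>
      adj_mat vs G $$ (i, j) \<in> {0, 1}"
    by simp
qed

end
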